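(* For $\mathrm{Re}(s)>1$ let $\varsigma(s)=\sum_{n=1}^{+\infty}\frac{1}{n^s}$. Then $\varsigma(2)=\frac{\pi^2}{6}$ and $\varsigma(4)=\frac{\pi^4}{90}$. More generally, for every positive integer $l$ the following recurrence formula holds: \[ \varsigma(2l)=\left(\frac{2^{2l-1}}{1-2^{2l}}\right)\left\{\left[\frac{(-1)^{l+1}}{4l}+\frac{(-1)^l}{2}\right]\frac{\pi^{2l}}{\Gamma(2l)}+\sum_{j=1}^{l-1}\frac{(-1)^{l-j}\pi^{2(l-j)}}{\Gamma(2(l-j)+1)}\,\varsigma(2j)\right\}, \] where the sum over $j$ is $0$ when $l=1$.
   Context: $\Gamma(z)$ denotes the gamma function. The convention $\sum_{k=1}^{0}a(k)=0$ is used for empty sums. *)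

theory Defs
  imports "HOL-Analysis.Analysis"
begin

text \<open>The series is only meaningful for \<^prop>\<open>Re s > 1\<close>, where it converges (see below);
  the index is shifted because \<^const>\<open>suminf\<close> starts at 0.\<close>

definition zeta :: "complex \<Rightarrow> complex" where
  "zeta s = (\<Sum>n. 1 / of_nat (Suc n) powr s)"

lemma summable_zeta:
  assumes "Re s > 1"
  shows "summable (\<lambda>n. 1 / of_nat (Suc n) powr s :: complex)"
proof -
  have "summable (\<lambda>n. exp (of_real (ln (of_nat n)) * (- s)) :: complex)"
    using assms by (intro summable_complex_powr_iff) simp
  then have "summable (\<lambda>n. exp (of_real (ln (of_nat (Suc n))) * (- s)) :: complex)"
    by (subst summable_Suc_iff)
  moreover have "exp (of_real (ln (of_nat (Suc n))) * (- s)) = 1 / of_nat (Suc n) powr s" for n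
    by (simp add: powr_def exp_minus field_simps Ln_of_nat del: of_nat_Suc)
  ultimately show ?thesis
    by (simp only:)
qed

end

(* The logarithmic derivative of the reflection formula of the Gamma function, together with the
   Taylor coefficients Polygamma n 1 / n! of Digamma at 1, identifies the even generating function
   h(z) = -1 + 2 * (zeta(2) z^2 + zeta(4) z^4 + ...) with -pi z cot(pi z).
   The half-angle formulas turn this into
     cos(pi z) h(z) + h(z) = 2 h(z/2) + pi z sin(pi z),
   and comparing the coefficients of z^(2l) gives the recurrence. *)
theory Submission
  imports Defs "HOL-Complex_Analysis.Complex_Analysis"
begin

lemma zeta_of_nat: "zeta (of_nat n) = (\<Sum>k. inverse (of_nat (Suc k) ^ n))"
proof -
  have "1 / of_nat (Suc k) powr of_nat n = inverse (of_nat (Suc k) ^ n :: complex)" for k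
    by (subst powr_nat') (auto simp: inverse_eq_divide simp del: of_nat_Suc)
  thus ?thesis
    unfolding zeta_def by (simp only:)
qed

text \<open>At 1 the defining series of \<open>Polygamma n\<close> is the zeta series. For
  \<open>n = 0\<close> that would be the divergent harmonic series.\<close>

lemma Polygamma_one_eq_zeta:
  assumes "n > 0"
  shows "Polygamma n 1 = (-1) ^ Suc n * fact n * zeta (of_nat (Suc n))"
  using assms unfolding zeta_of_nat by (simp add: Polygamma_def del: power_Suc)

text \<open>Both sides of rGamma(z) rGamma(1 - z) = sin(pi z) / pi are differentiated and the
  derivatives compared. Multiplying out avoids dividing by the sine.\<close>

lemma Digamma_reflection:
  fixes z :: complex
  assumes z: "z \<notin> \<int>"
  shows "sin (of_real pi * z) * (Digamma (1 - z) - Digamma z) = of_real pi * cos (of_real pi * z)"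
proof -
  have [simp]: "z \<notin> \<int>\<^sub>\<le>\<^sub>0" "1 - z \<notin> \<int>\<^sub>\<le>\<^sub>0"
    using z by (metis Ints_1 Ints_diff diff_diff_eq2 add_diff_cancel_left'
          nonpos_Ints_Int subsetD subsetI)+
  have "((\<lambda>z. rGamma z * rGamma (1 - z)) has_field_derivative
          rGamma z * rGamma (1 - z) * (Digamma (1 - z) - Digamma z)) (at z)"
    by (auto intro!: derivative_eq_intros simp: algebra_simps)
  moreover have "((\<lambda>z. sin (of_real pi * z) / of_real pi) has_field_derivative
          cos (of_real pi * z)) (at z)"
    by (auto intro!: derivative_eq_intros)
  ultimately have "rGamma z * rGamma (1 - z) * (Digamma (1 - z) - Digamma z) = cos (of_real pi * z)"
    unfolding rGamma_reflection_complex by (rule DERIV_unique)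
  thus ?thesis
    by (simp add: rGamma_reflection_complex field_simps)
qed

text \<open>Near 0 this is \<open>- pi z cot (pi z)\<close>, in a form that is visibly holomorphic at 0.\<close>

definition cot_series :: "complex \<Rightarrow> complex" where
  "cot_series z = z * (Digamma (1 + z) - Digamma (1 - z)) - 1"

text \<open>The recurrence Digamma(1 + z) = Digamma(z) + 1/z reduces this to the reflection formula;
  the -1 in \<open>cot_series\<close> absorbs z * (1/z). In the unit disc the only integer is 0,
  where both sides vanish.\<close>

lemma sin_mult_cot_series:
  assumes "norm z < 1"
  shows "sin (of_real pi * z) * cot_series z = - of_real pi * z * cos (of_real pi * z)"
proof (cases "z = 0")
  case False
  with assms have z: "z \<notin> \<int>"
    by (auto elim!: Ints_cases)
  have "Digamma (1 + z) = Digamma z + 1 / z"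
    using False Digamma_plus1[of z] by (simp add: add.commute)
  hence "cot_series z = - z * (Digamma (1 - z) - Digamma z)"
    using False by (simp add: cot_series_def field_simps)
  thus ?thesis
    using Digamma_reflection[OF z] by (simp only: ring_distribs) (simp add: mult_ac; algebra)
qed simp

lemma cot_series_duplication:
  assumes z: "norm z < 1"
  shows "cos (of_real pi * z) * cot_series z + cot_series z =
           2 * cot_series ((1/2) * z) + of_real pi * (z * sin (of_real pi * z))"
proof (cases "z = 0")
  case False
  define w where "w = of_real pi * z / 2"
  define s c where "s = sin w" and "c = cos w"
  have w: "of_real pi * z = 2 * w" "of_real pi * ((1/2) * z) = w"
    by (simp_all add: w_def)
  have sc: "c ^ 2 = 1 - s ^ 2"
    by (simp add: s_def c_def cos_squared_eq)
  have s2: "sin (2 * w) = 2 * s * c" "cos (2 * w) = 1 - 2 * s ^ 2"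
    by (simp_all add: s_def c_def sin_double cos_double_sin)
  \<comment> \<open>The zeros of sin(pi z / 2) are the even integers, and the only one in the unit
    disc is the excluded z = 0. So the identity may be proved after multiplication by
    \<open>s\<close>.\<close>
  have "s \<noteq> 0"
  proof
    assume "s = 0"
    then obtain n :: int where "w = of_real (of_int n * pi)"
      by (auto simp: s_def sin_eq_0)
    hence "z = of_int (2 * n)"
      by (simp add: w_def)
    with z False show False by auto
  qed
  have 1: "2 * s * c * cot_series z = - 2 * w * (1 - 2 * s ^ 2)"
    using sin_mult_cot_series[OF z] by (simp only: w s2 mult_minus_left)
  have 2: "s * cot_series ((1/2) * z) = - w * c"
  proof -
    have "norm ((1/2) * z) < 1"
      using z by (simp add: norm_mult)
    from sin_mult_cot_series[OF this] show ?thesis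
      by (simp only: w s_def c_def mult_minus_left)
  qed
  \<comment> \<open>cos(2w) + 1 = 2 c^2 makes the factor sin(2w) = 2 s c appear, to which fact
    \<open>1\<close> applies.\<close>
  have "s * ((1 - 2 * s ^ 2) * cot_series z + cot_series z) = c * (2 * s * c * cot_series z)"
    using sc by algebra
  also have "\<dots> = s * (2 * cot_series ((1/2) * z) + 2 * w * (2 * s * c))"
    using 1 2 sc by algebra
  finally show ?thesis
    unfolding mult_left_cancel[OF \<open>s \<noteq> 0\<close>]
    by (simp only: w s2 mult.assoc[symmetric])
qed (simp add: cot_series_def)

text \<open>The constant term is set apart because the series \<open>zeta\<close> diverges at 0; it
  agrees with 2 zeta(0) for the continued function, where zeta(0) = -1/2.\<close>

definition cot_fps :: "complex fps" where
  "cot_fps = Abs_fps (\<lambda>n. if n = 0 then -1 else if even n then 2 * zeta (of_nat n) else 0)"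

text \<open>Subtracting the expansion at -z doubles the odd coefficients of Digamma(1 + z) and kills
  the even ones. For odd n the coefficient is zeta(n + 1), and the factor z shifts it to index n +
  1.\<close>

lemma cot_series_has_fps_expansion: "cot_series has_fps_expansion cot_fps"
proof -
  define P where "P = fps_expansion (\<lambda>z::complex. Digamma (1 + z)) 0"
  have "(\<lambda>z::complex. Digamma (1 + z)) holomorphic_on ball 0 1"
  proof -
    have "x \<notin> \<int>\<^sub>\<le>\<^sub>0" if "x \<in> ball 1 1" for x :: complex
      using that abs_Re_le_cmod[of "1 - x"] by (auto elim!: nonpos_Ints_cases' simp: dist_norm)
    hence "ball (1 :: complex) 1 \<inter> \<int>\<^sub>\<le>\<^sub>0 = {}"
      by blast
    hence "Digamma holomorphic_on (\<lambda>z. 1 + z) ` ball (0 :: complex) 1"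
      by (intro holomorphic_on_Polygamma) simp
    thus ?thesis
      using holomorphic_on_compose[of "\<lambda>z. 1 + z" "ball 0 1" Digamma]
      by (simp add: o_def holomorphic_intros)
  qed
  hence P: "(\<lambda>z. Digamma (1 + z)) has_fps_expansion P"
    unfolding P_def by (intro has_fps_expansion_fps_expansion[of "ball 0 1"]) auto
  have P_nth: "fps_nth P n = Polygamma n 1 / fact n" for n
    using higher_deriv_shift_0[of n "Digamma :: complex \<Rightarrow> complex" 1]
      higher_deriv_Polygamma[of "1 :: complex" n 0]
    by (simp add: fps_nth_fps_expansion[OF P] o_def)
  have "(\<lambda>z. -1 * z) has_fps_expansion fps_const (-1 :: complex) * fps_X"
    by (intro fps_expansion_intros)
  from has_fps_expansion_compose[OF P this]
  have P': "(\<lambda>z. Digamma (1 - z)) has_fps_expansion (P oo (fps_const (-1) * fps_X))"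
    by (simp add: o_def)
  have "cot_series has_fps_expansion fps_X * (P - (P oo (fps_const (-1) * fps_X))) - 1"
    unfolding cot_series_def by (intro fps_expansion_intros P P')
  also have "fps_X * (P - (P oo (fps_const (-1) * fps_X))) - 1 = cot_fps"
  proof (rule fps_ext)
    fix n
    show "fps_nth (fps_X * (P - (P oo (fps_const (-1) * fps_X))) - 1) n = fps_nth cot_fps n"
    proof (cases n)
      \<comment> \<open>\<open>m = 0\<close> is split off because
        \<open>Polygamma_one_eq_zeta\<close> excludes it; there the two copies of Digamma(1)
        cancel.\<close>
      case (Suc m)
      thus ?thesis
        by (cases "m = 0")
           (auto simp: cot_fps_def P_nth Polygamma_one_eq_zeta
                 simp del: of_nat_Suc fps_const_neg)
    qed (auto simp: cot_fps_def)
  qed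
  finally show ?thesis .
qed

lemma cot_fps_duplication:
  "fps_cos (of_real pi) * cot_fps + cot_fps =
     fps_const 2 * (cot_fps oo (fps_const (1/2) * fps_X)) +
     fps_const (of_real pi) * (fps_X * fps_sin (of_real pi))"
proof (rule fps_expansion_unique_complex)
  show "(\<lambda>z. cos (of_real pi * z) * cot_series z + cot_series z) has_fps_expansion
          fps_cos (of_real pi) * cot_fps + cot_fps"
    by (intro fps_expansion_intros cot_series_has_fps_expansion)
  have "(\<lambda>z. (1/2) * z) has_fps_expansion fps_const (1/2 :: complex) * fps_X"
    by (intro fps_expansion_intros)
  from has_fps_expansion_compose[OF cot_series_has_fps_expansion this]
  have "(\<lambda>z. cot_series ((1/2) * z)) has_fps_expansion (cot_fps oo (fps_const (1/2) * fps_X))"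
    by (simp add: o_def)
  hence *: "(\<lambda>z. 2 * cot_series ((1/2) * z) + of_real pi * (z * sin (of_real pi * z))) has_fps_expansion
     fps_const 2 * (cot_fps oo (fps_const (1/2) * fps_X)) +
     fps_const (of_real pi) * (fps_X * fps_sin (of_real pi))"
    by (intro fps_expansion_intros)
  \<comment> \<open>The duplication identity is known only in the unit disc, but agreement near 0
    already determines the power series.\<close>
  have "eventually (\<lambda>z. z \<in> ball 0 1) (nhds (0 :: complex))"
    by (intro eventually_nhds_in_open) auto
  hence "eventually (\<lambda>z. 2 * cot_series ((1/2) * z) + of_real pi * (z * sin (of_real pi * z)) =
           cos (of_real pi * z) * cot_series z + cot_series z) (nhds 0)"
    by eventually_elim (use cot_series_duplication in \<open>simp\<close>)
  from has_fps_expansion_cong[OF this refl] *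
  show "(\<lambda>z. cos (of_real pi * z) * cot_series z + cot_series z) has_fps_expansion
     fps_const 2 * (cot_fps oo (fps_const (1/2) * fps_X)) +
     fps_const (of_real pi) * (fps_X * fps_sin (of_real pi))"
    by blast
qed

lemma zeta_even_recurrence:
  assumes l: "l \<ge> 1"
  shows "zeta (of_nat (2 * l)) =
        (2 ^ (2 * l - 1) / (1 - 2 ^ (2 * l))) *
        (((-1) ^ (l + 1) / (4 * of_nat l) + (-1) ^ l / 2) *
            ((of_real pi) ^ (2 * l) / Gamma (of_nat (2 * l)))
         + (\<Sum>j = 1..l - 1.
              (-1) ^ (l - j) * (of_real pi) ^ (2 * (l - j)) / Gamma (of_nat (2 * (l - j) + 1))
                * zeta (of_nat (2 * j))))"
proof -
  define S where "S = (\<Sum>j = 1..l - 1. (-1) ^ (l - j) * (of_real pi) ^ (2 * (l - j)) /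
     Gamma (of_nat (2 * (l - j) + 1)) * zeta (of_nat (2 * j)))"
  define Z where "Z = zeta (of_nat (2 * l))"
  define g :: complex where "g = fact (2 * l - 1)"
  \<comment> \<open>Since (2l)! = 2l (2l - 1)!, the coefficient of z^(2l) in cos(pi z) is p/(2l),
    while in pi z sin(pi z) it is -p. The factor 1/q comes from replacing z by z/2.\<close>
  define p :: complex where "p = (-1) ^ l * of_real pi ^ (2 * l) / g"
  define q :: complex where "q = 2 ^ (2 * l)"
  have g: "Gamma (of_nat (2 * l)) = g" "fact (2 * l) = 2 * of_nat l * g" "g \<noteq> 0"
    using l Gamma_fact[of "2 * l - 1", where ?'a = complex]
      fact_reduce[of "2 * l", where ?'a = complex]
    by (auto simp: g_def of_nat_diff)
  have Gamma_eq: "Gamma (of_nat (2 * k + 1)) = (fact (2 * k) :: complex)" for k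
    using Gamma_fact[of "2 * k", where ?'a = complex] by (simp add: add.commute)
  define C H where "C = fps_nth (fps_cos (complex_of_real pi))" and "H = fps_nth cot_fps"
  have "fps_nth (fps_cos (of_real pi) * cot_fps) (2 * l) =
          (\<Sum>i = 0..2 * l. H i * C (2 * l - i))"
    by (subst mult.commute) (simp add: fps_mult_nth C_def H_def)
  \<comment> \<open>The odd coefficients of \<open>cot_fps\<close> vanish.\<close>
  also have "\<dots> = (\<Sum>i\<in>(*) 2 ` {0..l}. H i * C (2 * l - i))"
    by (rule sum.mono_neutral_right) (auto simp: H_def cot_fps_def elim!: evenE)
  also have "\<dots> = (\<Sum>j = 0..l. H (2 * j) * C (2 * l - 2 * j))"
    by (subst sum.reindex) (auto simp: inj_on_def)
  \<comment> \<open>The end terms are special: j = 0 brings in the constant term -1, and j = l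
    contains the unknown \<open>Z\<close>. The terms between form \<open>2 * S\<close>.\<close>
  also have "{0..l} = insert 0 (insert l {1..l - 1})"
    using l by auto
  also have "(\<Sum>j\<in>\<dots>. H (2 * j) * C (2 * l - 2 * j)) =
               - p / (2 * of_nat l) + 2 * Z +
               (\<Sum>j=1..l - 1. H (2 * j) * C (2 * l - 2 * j))"
    using l by (subst sum.insert; simp)+ (simp add: H_def cot_fps_def C_def fps_cos_def p_def Z_def g)
  also have "(\<Sum>j=1..l - 1. H (2 * j) * C (2 * l - 2 * j)) = 2 * S"
    unfolding S_def sum_distrib_left Gamma_eq
    by (rule sum.cong) (auto simp: H_def cot_fps_def C_def fps_cos_def simp flip: diff_mult_distrib2)
  finally have 1: "fps_nth (fps_cos (of_real pi) * cot_fps) (2 * l) = - p / (2 * of_nat l) + 2 * Z + 2 * S" .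
  have 2: "fps_nth cot_fps (2 * l) = 2 * Z"
    using l by (simp add: cot_fps_def Z_def)
  have 3: "fps_nth (fps_const 2 * (cot_fps oo (fps_const (1/2) * fps_X))) (2 * l) = 4 * Z / q"
    by (simp only: fps_mult_left_const_nth fps_nth_compose_linear 2) (simp add: q_def power_divide)
  obtain m where m: "l = Suc m" using l by (cases l) auto
  have 4: "fps_nth (fps_const (of_real pi) * (fps_X * fps_sin (of_real pi))) (2 * l) = - p"
    by (simp add: m fps_sin_def p_def g_def mult_ac distrib_right distrib_left)
  have "(of_nat (2 ^ (2 * l)) :: complex) \<noteq> of_nat 1"
    unfolding of_nat_eq_iff using l by simp
  hence q: "q \<noteq> 0" "1 - q \<noteq> 0"
    by (simp_all add: q_def)
  \<comment> \<open>This is the comparison of the coefficients of z^(2l). It is linear in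
    \<open>Z\<close> with leading factor 4 (1 - 1/q), hence solvable because \<open>q\<close> is not
    1.\<close>
  have "- p / (2 * of_nat l) + 2 * Z + 2 * S + 2 * Z = 4 * Z / q - p"
    using arg_cong[OF cot_fps_duplication, of "\<lambda>F. fps_nth F (2 * l)"]
    by (simp only: fps_add_nth 1 2 3 4) simp
  hence "Z = (q / 2) / (1 - q) * ((-1 / (4 * of_nat l) + 1 / 2) * p + S)"
    using q l by (simp add: field_simps)
  also have "q / 2 = 2 ^ (2 * l - 1)"
    by (simp add: q_def m)
  also have "(-1 / (4 * of_nat l) + 1 / 2) * p =
    ((-1) ^ (l + 1) / (4 * of_nat l) + (-1) ^ l / 2) * (of_real pi ^ (2 * l) / g)"
    by (simp add: p_def algebra_simps add_divide_distrib diff_divide_distrib)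
  finally show ?thesis
    by (simp only: S_def Z_def g q_def)
qed

theorem mainTheorem1:
  "zeta 2 = (of_real pi)^2 / 6 \<and>
   zeta 4 = (of_real pi)^4 / 90 \<and>
   (\<forall>l::nat. l \<ge> 1 \<longrightarrow>
      zeta (of_nat (2 * l)) =
        (2 ^ (2 * l - 1) / (1 - 2 ^ (2 * l))) *
        (((-1) ^ (l + 1) / (4 * of_nat l) + (-1) ^ l / 2) *
            ((of_real pi) ^ (2 * l) / Gamma (of_nat (2 * l)))
         + (\<Sum>j = 1..l - 1.
              (-1) ^ (l - j) * (of_real pi) ^ (2 * (l - j)) / Gamma (of_nat (2 * (l - j) + 1))
                * zeta (of_nat (2 * j)))))"
proof (intro conjI allI impI zeta_even_recurrence)
  \<comment> \<open>These are the Gamma values that occur for l = 1 and l = 2; in the latter case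
    the sum has the single term j = 1, which involves zeta(2).\<close>
  have Gamma: "Gamma 2 = (1 :: complex)" "Gamma 3 = (2 :: complex)" "Gamma 4 = (6 :: complex)"
    using Gamma_fact[of 1, where ?'a = complex] Gamma_fact[of 2, where ?'a = complex]
      Gamma_fact[of 3, where ?'a = complex] by (simp_all add: fact_numeral)
  show zeta_2: "zeta 2 = of_real pi ^ 2 / 6"
    using zeta_even_recurrence[of 1] by (simp add: Gamma)
  show "zeta 4 = of_real pi ^ 4 / 90"
    using zeta_even_recurrence[of 2] by (simp add: Gamma zeta_2 field_simps
        power2_eq_square power4_eq_xxxx)
qed

end
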